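(* Let $G$ be a bipartite graph on $n$ vertices with minimum degree $\delta(G)\ge 1$. Then $$f_o(G)\ \ge\ \Bigl(\frac14+\frac1{256}\Bigr)n\ =\ \frac{65n}{256}.$$
   Context: All graphs are finite and simple (no loops, no multiple edges). $f_o(G)$ denotes the maximum size of a set $S\subseteq V(G)$ such that every vertex of the induced subgraph $G[S]$ has odd degree in $G[S]$ (the empty set is vacuously allowed). *)

theory Defs
  imports Complex_Main "Graph_Theory.Digraph_Component"
begin

text \<open>
  A finite simple undirected graph is a \<^locale>\<open>graph\<close>: a finite symmetric digraph without loops
  or parallel arcs, every undirected edge being a pair of opposite arcs. Hence the undirected
  degree of \<open>v\<close> is \<^term>\<open>out_degree G v\<close>, as the next lemma confirms.
\<close>

lemma (in nomulti_digraph) out_degree_eq_card_neighbours: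
  "out_degree G v = card {u. (v, u) \<in> arcs_ends G}"
proof -
  have "inj_on (head G) (out_arcs G v)"
    by (intro inj_onI) (auto simp: arc_to_ends_def intro: no_multi_arcs)
  moreover have "head G ` out_arcs G v = {u. (v, u) \<in> arcs_ends G}"
    by (auto simp: arcs_ends_conv)
  ultimately show ?thesis
    by (metis card_image out_degree_def)
qed

definition bipartite :: "('a, 'b) pre_digraph \<Rightarrow> bool" where
  "bipartite G \<longleftrightarrow>
     (\<exists>A B. A \<union> B = verts G \<and> A \<inter> B = {} \<and>
        (\<forall>(u, v) \<in> arcs_ends G. (u \<in> A \<and> v \<in> B) \<or> (u \<in> B \<and> v \<in> A)))"

text \<open>Unspecified for the graph without vertices, since it takes the \<^const>\<open>Min\<close> of the empty set.\<close>

definition min_degree :: "('a, 'b) pre_digraph \<Rightarrow> nat" where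
  "min_degree G = Min (out_degree G ` verts G)"

definition odd_induced :: "('a, 'b) pre_digraph \<Rightarrow> 'a set \<Rightarrow> bool" where
  "odd_induced G S \<longleftrightarrow> S \<subseteq> verts G \<and> (\<forall>v \<in> S. odd (out_degree (G \<restriction> S) v))"

definition f_o :: "('a, 'b) pre_digraph \<Rightarrow> nat" where
  "f_o G = Max {card S | S. odd_induced G S}"

text \<open>The maximum is taken over a finite nonempty set, so it is attained.\<close>

lemma (in fin_digraph) f_o_attained:
  "\<exists>S. odd_induced G S \<and> card S = f_o G"
  "odd_induced G S \<Longrightarrow> card S \<le> f_o G"
proof -
  let ?C = "{card S | S. odd_induced G S}"
  have "?C \<subseteq> card ` Pow (verts G)"
    by (auto simp: odd_induced_def)
  then have fin: "finite ?C"
    by (rule finite_subset) simp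
  have "odd_induced G {}"
    by (simp add: odd_induced_def)
  then have "?C \<noteq> {}" by blast
  with fin have "Max ?C \<in> ?C" by (rule Max_in)
  then show "\<exists>S. odd_induced G S \<and> card S = f_o G"
    by (auto simp: f_o_def)
  show "card S \<le> f_o G" if "odd_induced G S"
    unfolding f_o_def using fin that by (intro Max_ge) auto
qed

end

theory Submission
  imports Defs
begin

text \<open>
  Let \<open>M\<close> be the biadjacency matrix over \<open>\<bbbF>\<^sub>2\<close> of the bipartite graph with sides \<open>A\<close>, \<open>B\<close>, let \<open>r\<close>
  be its rank, and let \<open>v = M x\<close> and \<open>w = M\<^sup>T y\<close> be words of maximum weight in its column and row
  spaces. Maximality of \<open>v\<close> means that no nonzero word of the column space vanishes on the support
  \<open>A'\<close> of \<open>v\<close>, so the rows in \<open>A'\<close> span the row space and \<open>y\<close> can be replaced by a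
  vector supported on all but at most \<open>r\<close> elements of \<open>A'\<close>; likewise \<open>x\<close> by one supported on all but
  at most \<open>r\<close> elements of the support \<open>B'\<close> of \<open>w\<close>. The union of the two supports induces odd degrees.
  This gives \<open>f\<^sub>o \<ge> |A'| + |B'| - 2r\<close>. Keeping \<open>x\<close> small instead and
  imposing the parity conditions only there gives \<open>f\<^sub>o \<ge> |A'|\<close>.

  A random word whose \<open>r\<close> coordinates on an information set are independently \<open>1\<close> with
  probability \<open>9/16\<close> has expected weight at least \<open>(63 |A| + 9 r) / 128\<close>, as every other
  coordinate is \<open>1\<close> with probability at least \<open>(1 - 1/64) / 2\<close>. With \<open>A\<close> the larger side, the second
  bound suffices if \<open>r \<ge> n / 8\<close>, and the first one otherwise.
\<close>

section \<open>Sums over the field with two elements\<close>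

text \<open>Vectors over the two-element field are represented by their supports:
  \<open>odd_in (E a) X\<close> is the coordinate at \<open>a\<close> of the matrix \<open>E\<close>
  applied to \<open>X\<close>, and \<open>sym_diff\<close> is vector addition.\<close>

definition odd_in :: "('a \<Rightarrow> bool) \<Rightarrow> 'a set \<Rightarrow> bool" where
  "odd_in P X \<longleftrightarrow> odd (card {x \<in> X. P x})"

lemma odd_in_empty [simp]: "\<not> odd_in P {}"
  by (simp add: odd_in_def)

lemma odd_in_singleton [simp]: "odd_in P {x} \<longleftrightarrow> P x"
proof -
  have "{y \<in> {x}. P y} = (if P x then {x} else {})" by auto
  then show ?thesis by (simp add: odd_in_def)
qed

lemma odd_in_sym_diff:
  assumes "finite X" "finite Z"
  shows "odd_in P (sym_diff X Z) \<longleftrightarrow> odd_in P X \<noteq> odd_in P Z"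
proof -
  let ?X = "{x \<in> X. P x}" and ?Z = "{x \<in> Z. P x}"
  have "{x \<in> sym_diff X Z. P x} = (?X - ?Z) \<union> (?Z - ?X)" by auto
  moreover have "card ((?X - ?Z) \<union> (?Z - ?X)) = card (?X - ?Z) + card (?Z - ?X)"
    using assms by (intro card_Un_disjoint) auto
  moreover have "card ?X = card (?X - ?Z) + card (?X \<inter> ?Z)"
    using assms by (subst card_Un_disjoint[symmetric]) (auto intro: arg_cong[of _ _ card])
  moreover have "card ?Z = card (?Z - ?X) + card (?X \<inter> ?Z)"
    using assms by (subst card_Un_disjoint[symmetric]) (auto intro: arg_cong[of _ _ card])
  ultimately show ?thesis by (simp only: odd_in_def even_add) blast
qed

lemma odd_in_cong:
  assumes "\<And>x. x \<in> X \<Longrightarrow> P x \<longleftrightarrow> Q x"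
  shows "odd_in P X \<longleftrightarrow> odd_in Q X"
proof -
  have "{x \<in> X. P x} = {x \<in> X. Q x}" using assms by auto
  then show ?thesis by (simp add: odd_in_def)
qed

text \<open>Symmetry of the scalar product; it turns a combination of coordinates into a sum of
  rows.\<close>

lemma odd_in_Collect: "odd_in P {x \<in> X. Q x} \<longleftrightarrow> odd_in Q {x \<in> X. P x}"
proof -
  have "{x \<in> {x \<in> X. Q x}. P x} = {x \<in> {x \<in> X. P x}. Q x}" by auto
  then show ?thesis by (simp add: odd_in_def)
qed

lemma odd_in_insert:
  assumes "finite X" "x \<notin> X"
  shows "odd_in P (insert x X) \<longleftrightarrow> P x \<noteq> odd_in P X"
proof -
  have "insert x X = sym_diff X {x}" using assms by auto
  then show ?thesis using odd_in_sym_diff[of X "{x}" P] assms by auto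
qed

lemma odd_in_eq_elem:
  assumes "finite U" shows "odd_in (\<lambda>x. a = x) U \<longleftrightarrow> a \<in> U"
proof -
  have "{x \<in> U. a = x} = (if a \<in> U then {a} else {})" by auto
  then show ?thesis by (simp add: odd_in_def)
qed

section \<open>Information sets of binary codes\<close>

text \<open>
  \<open>R\<close> is an information set of the code spanned by the columns \<open>b \<in> B\<close>, on the coordinates \<open>A\<close>:
  the word determined by its restriction \<open>U\<close> to \<open>R\<close> has coordinate \<^term>\<open>odd_in (t a) U\<close> at \<open>a\<close>.
\<close>

definition information_set ::
    "('a \<Rightarrow> 'b \<Rightarrow> bool) \<Rightarrow> 'a set \<Rightarrow> 'b set \<Rightarrow> 'a set \<Rightarrow> ('a \<Rightarrow> 'a \<Rightarrow> bool) \<Rightarrow> bool" where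
  "information_set E A B R t \<longleftrightarrow> R \<subseteq> A \<and>
     (\<forall>U\<subseteq>R. \<exists>X\<subseteq>B. \<forall>a\<in>A. odd_in (E a) X \<longleftrightarrow> odd_in (t a) U) \<and>
     (\<forall>a\<in>R. \<forall>\<rho>\<in>R. t a \<rho> \<longleftrightarrow> a = \<rho>) \<and>
     (\<forall>X\<subseteq>B. \<forall>a\<in>A. odd_in (E a) X \<longleftrightarrow> odd_in (t a) {\<rho> \<in> R. odd_in (E \<rho>) X})"

lemma
  assumes "information_set E A B R t"
  shows information_set_subset: "R \<subseteq> A"
    and information_set_word: "U \<subseteq> R \<Longrightarrow> \<exists>X\<subseteq>B. \<forall>a\<in>A. odd_in (E a) X \<longleftrightarrow> odd_in (t a) U"
    and information_set_unit: "a \<in> R \<Longrightarrow> \<rho> \<in> R \<Longrightarrow> t a \<rho> \<longleftrightarrow> a = \<rho>"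
    and information_set_determines:
      "X \<subseteq> B \<Longrightarrow> a \<in> A \<Longrightarrow> odd_in (E a) X \<longleftrightarrow> odd_in (t a) {\<rho> \<in> R. odd_in (E \<rho>) X}"
  using assms by (simp_all add: information_set_def)

text \<open>A smallest subset of \<open>A'\<close> on which only the zero word vanishes serves as
  \<open>R\<close>. By minimality, for each \<open>\<rho>\<close> in \<open>R\<close> some nonzero
  word vanishes on the rest of \<open>R\<close>; these words form the basis dual to the coordinates
  in \<open>R\<close>.\<close>

lemma information_set_exists:
  assumes fin: "finite A" "finite B" and sub: "A' \<subseteq> A"
    and det: "\<And>X. X \<subseteq> B \<Longrightarrow> \<forall>a\<in>A'. \<not> odd_in (E a) X \<Longrightarrow> \<forall>a\<in>A. \<not> odd_in (E a) X"
  obtains R t where "R \<subseteq> A'" "information_set E A B R t"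
proof -
  define det_set where
    "det_set R \<longleftrightarrow> R \<subseteq> A' \<and>
       (\<forall>X\<subseteq>B. (\<forall>a\<in>R. \<not> odd_in (E a) X) \<longrightarrow> (\<forall>a\<in>A. \<not> odd_in (E a) X))" for R
  have "det_set A'" using det by (auto simp: det_set_def)
  then obtain R where R: "det_set R" and min: "\<And>Q. det_set Q \<Longrightarrow> card R \<le> card Q"
    using ex_has_least_nat[of det_set A' card] by blast
  have RA': "R \<subseteq> A'" and RA: "R \<subseteq> A" and finR: "finite R"
    using R sub finite_subset[OF _ fin(1)] finite_subset[OF _ finite_subset[OF sub fin(1)]]
    by (auto simp: det_set_def)
  have "\<exists>X\<subseteq>B. (\<forall>a\<in>R. odd_in (E a) X \<longleftrightarrow> a = \<rho>)" if \<rho>: "\<rho> \<in> R" for \<rho>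
  proof -
    have "card (R - {\<rho>}) < card R" using \<rho> finR by (intro psubset_card_mono) auto
    then have "\<not> det_set (R - {\<rho>})" using min[of "R - {\<rho>}"] by linarith
    then obtain X a where X: "X \<subseteq> B" "\<forall>a\<in>R - {\<rho>}. \<not> odd_in (E a) X" "a \<in> A" "odd_in (E a) X"
      using RA' unfolding det_set_def by blast
    \<comment> \<open>Otherwise \<open>X\<close> would give a nonzero word that vanishes on all of
      \<open>R\<close>.\<close>
    then have "odd_in (E \<rho>) X" using R unfolding det_set_def by blast
    with X show ?thesis by blast
  qed
  then obtain e where e: "\<And>\<rho>. \<rho> \<in> R \<Longrightarrow> e \<rho> \<subseteq> B"
      "\<And>\<rho> a. \<rho> \<in> R \<Longrightarrow> a \<in> R \<Longrightarrow> odd_in (E a) (e \<rho>) \<longleftrightarrow> a = \<rho>"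
    by metis
  \<comment> \<open>The columns of \<open>t\<close> are the basis words, a generator matrix in
    systematic form.\<close>
  define t where "t a \<rho> \<longleftrightarrow> odd_in (E a) (e \<rho>)" for a \<rho>
  have words: "\<exists>X\<subseteq>B. \<forall>a\<in>A. odd_in (E a) X \<longleftrightarrow> odd_in (t a) U" if "U \<subseteq> R" for U
  proof -
    have "finite U" using that finR by (rule finite_subset)
    then show ?thesis using that
    proof (induction U)
      case empty
      have "{} \<subseteq> B" by simp
      then show ?case by (metis odd_in_empty)
    next
      case (insert \<rho> U)
      then obtain X where X: "X \<subseteq> B" "\<forall>a\<in>A. odd_in (E a) X \<longleftrightarrow> odd_in (t a) U" by auto
      have e\<rho>: "e \<rho> \<subseteq> B" using e insert by auto
      have "finite X" "finite (e \<rho>)" using X(1) e\<rho> fin(2) by (simp_all add: finite_subset)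
      then have "odd_in (E a) (sym_diff X (e \<rho>)) \<longleftrightarrow> odd_in (t a) (insert \<rho> U)" if "a \<in> A" for a
        using X(2) that t_def[of a \<rho>]
        by (simp only: odd_in_sym_diff odd_in_insert[OF insert.hyps(1,2)]) blast
      moreover have "sym_diff X (e \<rho>) \<subseteq> B" using X e\<rho> by auto
      ultimately show ?case by blast
    qed
  qed
  have unit: "t a \<rho> \<longleftrightarrow> a = \<rho>" if "a \<in> R" "\<rho> \<in> R" for a \<rho>
    using e that by (simp add: t_def)
  have rep: "odd_in (E a) X \<longleftrightarrow> odd_in (t a) {\<rho> \<in> R. odd_in (E \<rho>) X}"
    if X: "X \<subseteq> B" and a: "a \<in> A" for X a
  proof -
    let ?U = "{\<rho> \<in> R. odd_in (E \<rho>) X}"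
    obtain Z where Z: "Z \<subseteq> B" "\<forall>a\<in>A. odd_in (E a) Z \<longleftrightarrow> odd_in (t a) ?U"
      using words[of ?U] by auto
    have finXZ: "finite X" "finite Z" using X Z(1) fin(2) by (simp_all add: finite_subset)
    \<comment> \<open>The word of \<open>X\<close> and the word rebuilt from its restriction agree
      on \<open>R\<close>; their difference vanishes there and hence on all of
      \<open>A\<close>.\<close>
    have "\<not> odd_in (E \<rho>) (sym_diff X Z)" if \<rho>: "\<rho> \<in> R" for \<rho>
    proof -
      have "odd_in (t \<rho>) ?U \<longleftrightarrow> odd_in (\<lambda>x. \<rho> = x) ?U"
        using unit \<rho> by (intro odd_in_cong) auto
      also have "\<dots> \<longleftrightarrow> odd_in (E \<rho>) X" using \<rho> finR by (subst odd_in_eq_elem) auto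
      finally show ?thesis using Z RA \<rho> odd_in_sym_diff[OF finXZ, of "E \<rho>"] by auto
    qed
    moreover have "sym_diff X Z \<subseteq> B" using X Z by auto
    ultimately have "\<not> odd_in (E a) (sym_diff X Z)" using R a unfolding det_set_def by blast
    then show ?thesis using Z a odd_in_sym_diff[OF finXZ, of "E a"] by auto
  qed
  have "information_set E A B R t"
    unfolding information_set_def using RA words unit rep by simp
  with RA' show ?thesis by (rule that)
qed

text \<open>The rows in \<open>R\<close> span the row space: applied to single columns, the
  determination property says that row \<open>a\<close> is the sum of the rows \<open>\<rho>\<close>
  in \<open>R\<close> with \<open>t a \<rho>\<close>.\<close>

lemma information_set_sum_rows:
  assumes "information_set E A B R t" "finite A" "Y \<subseteq> A"
  shows "\<exists>Y'\<subseteq>R. \<forall>b\<in>B. odd_in (\<lambda>a. E a b) Y' \<longleftrightarrow> odd_in (\<lambda>a. E a b) Y"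
proof -
  have RA: "R \<subseteq> A" using assms(1) by (rule information_set_subset)
  then have finR: "finite R" using assms(2) by (rule finite_subset)
  have row: "E a b \<longleftrightarrow> odd_in (\<lambda>\<rho>. E \<rho> b) {\<rho> \<in> R. t a \<rho>}" if "a \<in> A" "b \<in> B" for a b
  proof -
    have "{b} \<subseteq> B" using that by simp
    then have "odd_in (E a) {b} \<longleftrightarrow> odd_in (t a) {\<rho> \<in> R. odd_in (E \<rho>) {b}}"
      by (rule information_set_determines[OF assms(1) _ that(1)])
    then show ?thesis by (simp add: odd_in_Collect[of "t a"])
  qed
  have "finite Y" using assms(3,2) by (rule finite_subset)
  then show ?thesis using assms(3)
  proof (induction Y)
    case empty
    have "{} \<subseteq> R" by simp
    then show ?case by (metis odd_in_empty)
  next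
    case (insert a Y)
    then obtain Y' where Y': "Y' \<subseteq> R" "\<forall>b\<in>B. odd_in (\<lambda>a. E a b) Y' \<longleftrightarrow> odd_in (\<lambda>a. E a b) Y"
      by auto
    let ?T = "{\<rho> \<in> R. t a \<rho>}"
    have fin: "finite Y'" "finite ?T" using finite_subset[OF Y'(1) finR] finR by simp_all
    have "odd_in (\<lambda>a. E a b) (sym_diff Y' ?T) \<longleftrightarrow> odd_in (\<lambda>a. E a b) (insert a Y)"
      if "b \<in> B" for b
      using Y'(2) that row[of a b] insert.prems
      by (simp only: odd_in_sym_diff[OF fin] odd_in_insert[OF insert.hyps(1,2)]) blast
    moreover have "sym_diff Y' ?T \<subseteq> R" using Y' by auto
    ultimately show ?case by blast
  qed
qed

lemma information_set_restriction_surj: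
  assumes "information_set E A B R t" "finite A" "U \<subseteq> R"
  shows "\<exists>X\<subseteq>B. {\<rho> \<in> R. odd_in (E \<rho>) X} = U"
proof -
  note RA = information_set_subset[OF assms(1)] and unit = information_set_unit[OF assms(1)]
  have finU: "finite U" using assms RA by (meson finite_subset)
  obtain X where X: "X \<subseteq> B" "\<forall>a\<in>A. odd_in (E a) X \<longleftrightarrow> odd_in (t a) U"
    using information_set_word[OF assms(1,3)] by blast
  have "odd_in (E \<rho>) X \<longleftrightarrow> \<rho> \<in> U" if "\<rho> \<in> R" for \<rho>
  proof -
    have "odd_in (t \<rho>) U \<longleftrightarrow> odd_in (\<lambda>x. \<rho> = x) U"
      using unit that assms(3) by (intro odd_in_cong) auto
    then show ?thesis using X RA that odd_in_eq_elem[OF finU] by auto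
  qed
  then have "{\<rho> \<in> R. odd_in (E \<rho>) X} = U" using assms(3) by blast
  with X(1) show ?thesis by blast
qed

section \<open>Rank inequalities\<close>

text \<open>Counting vectors, 2 to the power of the dimension, replaces arguments about
  bases.\<close>

lemma card_le_if_Pow_surj:
  assumes "finite B" "finite R" "\<And>U. U \<subseteq> R \<Longrightarrow> \<exists>X\<subseteq>B. f X = U"
  shows "card R \<le> card B"
proof -
  have "Pow R \<subseteq> f ` Pow B"
  proof
    fix U assume "U \<in> Pow R"
    then obtain X where "X \<subseteq> B" "f X = U" using assms(3) by blast
    then show "U \<in> f ` Pow B" by blast
  qed
  then have "card (Pow R) \<le> card (Pow B)" using assms(1) by (intro surj_card_le) simp_all
  then show ?thesis by (simp add: card_Pow assms(1,2))
qed

lemma information_set_card_le: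
  assumes "information_set E A B R t" "finite A" "finite B"
  shows "card R \<le> card B"
proof (rule card_le_if_Pow_surj)
  show "finite R" using information_set_subset[OF assms(1)] assms(2) by (rule finite_subset)
  show "\<exists>X\<subseteq>B. {\<rho> \<in> R. odd_in (E \<rho>) X} = U" if "U \<subseteq> R" for U
    using assms(1,2) that by (rule information_set_restriction_surj)
qed fact

text \<open>Every sum of rows is already a sum of rows in \<open>R\<close>, and restrictions of such
  sums to \<open>S\<close> are arbitrary, so the subsets of \<open>R\<close> map onto those of
  \<open>S\<close>.\<close>

lemma column_rank_le_row_rank:
  assumes R: "information_set E A B R t" and S: "information_set (\<lambda>b a. E a b) B A S s"
    and fin: "finite A" "finite B"
  shows "card S \<le> card R"
proof (rule card_le_if_Pow_surj)
  show "finite R" using information_set_subset[OF R] fin(1) by (rule finite_subset)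
  show "finite S" using information_set_subset[OF S] fin(2) by (rule finite_subset)
  show "\<exists>Y\<subseteq>R. {\<sigma> \<in> S. odd_in (\<lambda>a. E a \<sigma>) Y} = U" if U: "U \<subseteq> S" for U
  proof -
    obtain Y where Y: "Y \<subseteq> A" "{\<sigma> \<in> S. odd_in (\<lambda>a. E a \<sigma>) Y} = U"
      using information_set_restriction_surj[OF S fin(2) U] by blast
    obtain Y' where Y': "Y' \<subseteq> R" "\<forall>b\<in>B. odd_in (\<lambda>a. E a b) Y' \<longleftrightarrow> odd_in (\<lambda>a. E a b) Y"
      using information_set_sum_rows[OF R fin(1) Y(1)] by blast
    have "S \<subseteq> B" using S by (rule information_set_subset)
    then have "{\<sigma> \<in> S. odd_in (\<lambda>a. E a \<sigma>) Y'} = U" using Y Y' by auto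
    then show ?thesis using Y' by blast
  qed
qed

section \<open>Solutions with large support\<close>

text \<open>Take all of \<open>A' - R\<close> and repair the column parities with rows in
  \<open>R\<close> only; at most \<open>card R\<close> elements of \<open>A'\<close> are
  lost.\<close>

lemma information_set_large_solution:
  assumes "information_set E A B R t" "finite A" "R \<subseteq> A'" "A' \<subseteq> A" "Y \<subseteq> A"
  shows "\<exists>Y'\<subseteq>A'. (\<forall>b\<in>B. odd_in (\<lambda>a. E a b) Y' \<longleftrightarrow> odd_in (\<lambda>a. E a b) Y)
           \<and> card A' \<le> card Y' + card R"
proof -
  have finA': "finite A'" using assms(4,2) by (rule finite_subset)
  have finR: "finite R" using assms(3) finA' by (rule finite_subset)
  obtain Y1 where Y1: "Y1 \<subseteq> R"
      "\<forall>b\<in>B. odd_in (\<lambda>a. E a b) Y1 \<longleftrightarrow> odd_in (\<lambda>a. E a b) (A' - R)"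
    using information_set_sum_rows[OF assms(1,2), of "A' - R"] assms(4) by auto
  obtain Y2 where Y2: "Y2 \<subseteq> R" "\<forall>b\<in>B. odd_in (\<lambda>a. E a b) Y2 \<longleftrightarrow> odd_in (\<lambda>a. E a b) Y"
    using information_set_sum_rows[OF assms(1,2,5)] by auto
  have finY: "finite Y1" "finite Y2" using Y1(1) Y2(1) finR by (simp_all add: finite_subset)
  \<comment> \<open>\<open>Y1\<close> cancels the contribution of \<open>A' - R\<close>, and
    \<open>Y2\<close> supplies that of \<open>Y\<close>.\<close>
  let ?D = "sym_diff Y1 Y2"
  let ?Y' = "sym_diff (A' - R) ?D"
  have "odd_in (\<lambda>a. E a b) ?Y' \<longleftrightarrow> odd_in (\<lambda>a. E a b) Y" if "b \<in> B" for b
    using Y1(2) Y2(2) that finA' finY by (simp only: odd_in_sym_diff finite_Diff finite_UnI) blast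
  moreover have "?Y' \<subseteq> A'" using Y1 Y2 assms(3) by auto
  moreover have "card A' \<le> card ?Y' + card R"
  proof -
    have "A' - R \<subseteq> ?Y'" using Y1 Y2 by auto
    then have "card (A' - R) \<le> card ?Y'" using finA' finY by (intro card_mono) auto
    moreover have "card A' = card (A' - R) + card R"
      using card_Diff_subset[OF finR assms(3)] card_mono[OF finA' assms(3)] by linarith
    ultimately show ?thesis by linarith
  qed
  ultimately show ?thesis by blast
qed

section \<open>Words of large weight\<close>

text \<open>For a random \<open>U\<close> containing each element independently with probability
  \<open>p\<close>, the expected sign \<open>(-1) ^ card {x \<in> U. P x}\<close> is a product over
  \<open>R\<close>, with a factor \<open>1 - 2 * p\<close> for each \<open>x\<close> satisfying
  \<open>P\<close>. The indicator of odd parity is (1 - sign) / 2.\<close>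

lemma sum_biased_parity:
  fixes p :: real
  assumes "finite R"
  shows "(\<Sum>U\<in>Pow R. p ^ card U * (1 - p) ^ card (R - U) * (if odd_in P U then 1 else 0))
         = (1 - (1 - 2 * p) ^ card {x \<in> R. P x}) / 2"
proof -
  let ?w = "\<lambda>U. p ^ card U * (1 - p) ^ card (R - U)"
  let ?s = "\<lambda>x. if P x then -1 else 1 :: real"
  have "(\<Sum>U\<in>Pow R. ?w U * (-1) ^ card {x \<in> U. P x})
      = (\<Sum>U\<in>Pow R. (\<Prod>x\<in>U. p * ?s x) * (\<Prod>x\<in>R - U. 1 - p))"
  proof (rule sum.cong)
    fix U assume "U \<in> Pow R"
    then have "finite U" using assms by (simp add: finite_subset)
    then have "(\<Prod>x\<in>U. ?s x) = (-1) ^ card {x \<in> U. P x}"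
      by (simp add: prod.If_cases Int_def)
    then show "?w U * (-1) ^ card {x \<in> U. P x} = (\<Prod>x\<in>U. p * ?s x) * (\<Prod>x\<in>R - U. 1 - p)"
      by (simp add: prod.distrib)
  qed simp
  also have "\<dots> = (\<Prod>x\<in>R. p * ?s x + (1 - p))"
    using assms by (rule prod_add[symmetric])
  also have "\<dots> = (\<Prod>x\<in>R. if P x then 1 - 2 * p else 1)"
    by (rule prod.cong) auto
  also have "\<dots> = (1 - 2 * p) ^ card {x \<in> R. P x}"
    using assms by (simp add: prod.If_cases Int_def)
  finally have signed: "(\<Sum>U\<in>Pow R. ?w U * (-1) ^ card {x \<in> U. P x})
      = (1 - 2 * p) ^ card {x \<in> R. P x}" .
  have "(\<Sum>U\<in>Pow R. ?w U) = (\<Prod>x\<in>R. p + (1 - p))"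
    by (subst prod_add[OF assms]) simp
  then have total: "(\<Sum>U\<in>Pow R. ?w U) = 1" by simp
  have "(\<Sum>U\<in>Pow R. ?w U * (if odd_in P U then 1 else 0))
      = (\<Sum>U\<in>Pow R. (?w U - ?w U * (-1) ^ card {x \<in> U. P x}) / 2)"
    by (rule sum.cong) (auto simp: odd_in_def)
  also have "\<dots> = (1 - (1 - 2 * p) ^ card {x \<in> R. P x}) / 2"
    by (simp add: sum_divide_distrib[symmetric] sum_subtractf signed total)
  finally show ?thesis .
qed

lemma information_set_heavy_word:
  assumes inf: "information_set E A B R t" and fin: "finite A"
    and rows: "\<And>a. a \<in> A \<Longrightarrow> \<exists>b\<in>B. E a b"
  shows "\<exists>X\<subseteq>B. 63 * card A + 9 * card R \<le> 128 * card {a \<in> A. odd_in (E a) X}"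
proof (rule ccontr)
  assume contra: "\<not> ?thesis"
  note RA = information_set_subset[OF inf] and unit = information_set_unit[OF inf]
  have finR: "finite R" using RA fin by (rule finite_subset)
  \<comment> \<open>The probability of \<open>U\<close> under the bias 9/16, for which
    \<open>1 - 2 * p\<close> is -1/8. A coordinate in \<open>R\<close> is then 1 with probability
    9/16 = 63/128 + 9/128.\<close>
  define w where "w U = (9 / 16 :: real) ^ card U * (1 - 9 / 16) ^ card (R - U)" for U :: "'a set"
  have w0: "w U > 0" for U by (simp add: w_def)
  let ?K = "63 * real (card A) + 9 * real (card R)"
  have light: "128 * real (card {a \<in> A. odd_in (t a) U}) < ?K" if U: "U \<subseteq> R" for U
  proof -
    obtain X where X: "X \<subseteq> B" "\<forall>a\<in>A. odd_in (E a) X \<longleftrightarrow> odd_in (t a) U"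
      using information_set_word[OF inf U] by blast
    from X(2) have "{a \<in> A. odd_in (E a) X} = {a \<in> A. odd_in (t a) U}" by auto
    moreover have "\<not> 63 * card A + 9 * card R \<le> 128 * card {a \<in> A. odd_in (E a) X}"
      using contra X(1) by blast
    ultimately show ?thesis by simp
  qed
  have prob: "(\<Sum>U\<in>Pow R. w U * (if odd_in (t a) U then 1 else 0))
      = (1 - (- 1 / 8) ^ card {\<rho> \<in> R. t a \<rho>}) / 2" for a
    using sum_biased_parity[OF finR, of "9 / 16" "t a"] by (simp add: w_def)
  have prob_R: "(\<Sum>U\<in>Pow R. w U * (if odd_in (t a) U then 1 else 0)) = 63 / 128 + 9 / 128"
    if "a \<in> R" for a
  proof -
    have "{\<rho> \<in> R. t a \<rho>} = {a}" using that unit by auto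
    then show ?thesis by (simp add: prob)
  qed
  have prob_A: "(\<Sum>U\<in>Pow R. w U * (if odd_in (t a) U then 1 else 0)) \<ge> 63 / 128"
    if a: "a \<in> A" for a
  proof -
    let ?k = "card {\<rho> \<in> R. t a \<rho>}"
    \<comment> \<open>With \<open>?k = 0\<close> every word would be 0 at \<open>a\<close>, but a
      column \<open>b\<close> with \<open>E a b\<close> is 1 there.\<close>
    have "?k \<noteq> 0"
    proof
      assume "?k = 0"
      then have none: "{\<rho> \<in> R. t a \<rho>} = {}" using finR by simp
      obtain b where b: "b \<in> B" "E a b" using rows a by blast
      then have "{b} \<subseteq> B" by simp
      then have "odd_in (E a) {b} \<longleftrightarrow> odd_in (t a) {\<rho> \<in> R. odd_in (E \<rho>) {b}}"
        by (rule information_set_determines[OF inf _ a])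
      moreover have "\<not> odd_in (t a) {\<rho> \<in> R. odd_in (E \<rho>) {b}}"
        by (subst odd_in_Collect) (simp add: none)
      ultimately show False using b by simp
    qed
    \<comment> \<open>Exponent 1 gives a negative value, and from exponent 2 on the absolute value
      is at most 1/64.\<close>
    have "(- 1 / 8 :: real) ^ ?k \<le> 1 / 64"
    proof (cases "?k = 1")
      case False
      then obtain j where j: "?k = j + 2"
        using \<open>?k \<noteq> 0\<close> by (metis One_nat_def Suc_1 add.commute add_2_eq_Suc not0_implies_Suc)
      have "(- 1 / 8 :: real) ^ j \<le> \<bar>(- 1 / 8) ^ j\<bar>" by (rule abs_ge_self)
      also have "\<dots> \<le> 1" by (simp add: power_abs power_le_one)
      finally show ?thesis by (simp add: j power_add power2_eq_square)
    qed simp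
    then show ?thesis by (simp add: prob)
  qed
  have "(\<Sum>a\<in>A. if a \<in> R then 9 / 128 else 0) = (\<Sum>a\<in>A \<inter> R. 9 / 128 :: real)"
    using fin by (rule sum.inter_restrict[symmetric])
  also have "A \<inter> R = R" using RA by blast
  finally have "?K / 128 = (\<Sum>a\<in>A. 63 / 128) + (\<Sum>a\<in>A. if a \<in> R then 9 / 128 else 0)"
    by simp
  also have "\<dots> = (\<Sum>a\<in>A. 63 / 128 + (if a \<in> R then 9 / 128 else 0))"
    by (rule sum.distrib[symmetric])
  also have "\<dots> \<le> (\<Sum>a\<in>A. \<Sum>U\<in>Pow R. w U * (if odd_in (t a) U then 1 else 0))"
  proof (rule sum_mono)
    fix a assume a: "a \<in> A"
    show "63 / 128 + (if a \<in> R then 9 / 128 else 0)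
        \<le> (\<Sum>U\<in>Pow R. w U * (if odd_in (t a) U then 1 else 0))"
    proof (cases "a \<in> R")
      case True
      then show ?thesis unfolding prob_R[OF True] by simp
    next
      case False
      then show ?thesis using prob_A[OF a] by (simp only: if_False add_0_right)
    qed
  qed
  also have "\<dots> = (\<Sum>U\<in>Pow R. \<Sum>a\<in>A. w U * (if odd_in (t a) U then 1 else 0))"
    by (rule sum.swap)
  also have "\<dots> = (\<Sum>U\<in>Pow R. w U * real (card {a \<in> A. odd_in (t a) U}))"
    by (simp add: sum_distrib_left[symmetric] sum.If_cases fin Int_def)
  also have "\<dots> < (\<Sum>U\<in>Pow R. w U * (?K / 128))"
  proof (rule sum_strict_mono)
    show "w U * real (card {a \<in> A. odd_in (t a) U}) < w U * (?K / 128)" if "U \<in> Pow R" for U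
      using light[of U] that w0[of U] by (intro mult_strict_left_mono) simp_all
  qed (use finR in auto)
  also have "\<dots> = (\<Sum>U\<in>Pow R. w U) * (?K / 128)"
    by (simp only: sum_distrib_right)
  \<comment> \<open>The probabilities sum to 1, so the chain ends with a number strictly below
    itself.\<close>
  also have "(\<Sum>U\<in>Pow R. w U) = (\<Prod>x\<in>R. 9 / 16 + (1 - 9 / 16))"
    unfolding w_def by (subst prod_add[OF finR]) simp
  finally show False by simp
qed

text \<open>Adding to a heaviest word a word that vanishes on its support would unite disjoint
  supports and increase the weight unless the added word is zero. Hence that support contains an
  information set \<open>R\<close>, and the averaging bound for this \<open>R\<close> passes to the
  maximum.\<close>

lemma heaviest_word:
  assumes fin: "finite A" "finite B" and rows: "\<And>a. a \<in> A \<Longrightarrow> \<exists>b\<in>B. E a b"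
  obtains X R t where "X \<subseteq> B" "information_set E A B R t" "R \<subseteq> {a \<in> A. odd_in (E a) X}"
    "63 * card A + 9 * card R \<le> 128 * card {a \<in> A. odd_in (E a) X}"
proof -
  let ?W = "\<lambda>X. {a \<in> A. odd_in (E a) X}"
  have "\<forall>X. X \<subseteq> B \<longrightarrow> card (?W X) < Suc (card A)"
    using fin by (auto simp: less_Suc_eq_le intro: card_mono)
  then obtain X where X: "X \<subseteq> B" and max: "\<And>Z. Z \<subseteq> B \<Longrightarrow> card (?W Z) \<le> card (?W X)"
    using ex_has_greatest_nat[of "\<lambda>X. X \<subseteq> B" "{}" "\<lambda>X. card (?W X)" "Suc (card A)"]
    by auto
  have det: "\<forall>a\<in>A. \<not> odd_in (E a) Z" if Z: "Z \<subseteq> B" "\<forall>a\<in>?W X. \<not> odd_in (E a) Z" for Z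
  proof -
    have finXZ: "finite X" "finite Z" using X Z(1) fin(2) by (simp_all add: finite_subset)
    have "sym_diff X Z \<subseteq> B" using X Z by auto
    then have le: "card (?W (sym_diff X Z)) \<le> card (?W X)" by (rule max)
    have union: "?W (sym_diff X Z) = ?W X \<union> ?W Z"
      using Z odd_in_sym_diff[OF finXZ] by auto
    have disjoint: "card (?W X \<union> ?W Z) = card (?W X) + card (?W Z)"
      using fin Z by (intro card_Un_disjoint) auto
    have "card (?W Z) = 0" using le[unfolded union disjoint] by simp
    then show ?thesis using fin(1) by auto
  qed
  have "?W X \<subseteq> A" by auto
  then obtain R t where R: "R \<subseteq> ?W X" "information_set E A B R t"
    using det by (rule information_set_exists[OF fin])
  obtain Z where Z: "Z \<subseteq> B" "63 * card A + 9 * card R \<le> 128 * card (?W Z)"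
    using information_set_heavy_word[OF R(2) fin(1) rows] by blast
  have "63 * card A + 9 * card R \<le> 128 * card (?W X)" using max[OF Z(1)] Z(2) by linarith
  with X R(2,1) show ?thesis by (rule that)
qed

section \<open>The two constructions and the choice between them\<close>

lemma bipartite_relation_odd_sets_le:
  assumes fin: "finite A" "finite B" and rows: "\<And>a. a \<in> A \<Longrightarrow> \<exists>b\<in>B. E a b"
    and cols: "\<And>b. b \<in> B \<Longrightarrow> \<exists>a\<in>A. E a b" and le: "card B \<le> card A"
  shows "\<exists>Y\<subseteq>A. \<exists>X\<subseteq>B. (\<forall>a\<in>Y. odd_in (E a) X) \<and> (\<forall>b\<in>X. odd_in (\<lambda>a. E a b) Y)
           \<and> 65 * (card A + card B) \<le> 256 * (card Y + card X)"
proof -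
  obtain X0 R t where X0: "X0 \<subseteq> B" and R: "information_set E A B R t"
    and R_sub: "R \<subseteq> {a \<in> A. odd_in (E a) X0}"
    and wA: "63 * card A + 9 * card R \<le> 128 * card {a \<in> A. odd_in (E a) X0}"
    by (rule heaviest_word[OF fin rows])
  obtain Y0 S s where Y0: "Y0 \<subseteq> A" and S: "information_set (\<lambda>b a. E a b) B A S s"
    and S_sub: "S \<subseteq> {b \<in> B. odd_in (\<lambda>a. E a b) Y0}"
    and wB: "63 * card B + 9 * card S \<le> 128 * card {b \<in> B. odd_in (\<lambda>a. E a b) Y0}"
    by (rule heaviest_word[OF fin(2,1) cols])
  define A' where "A' = {a \<in> A. odd_in (E a) X0}"
  define B' where "B' = {b \<in> B. odd_in (\<lambda>a. E a b) Y0}"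
  have A'A: "A' \<subseteq> A" and B'B: "B' \<subseteq> B" by (auto simp: A'_def B'_def)
  have RA': "R \<subseteq> A'" and SB': "S \<subseteq> B'" using R_sub S_sub by (simp_all add: A'_def B'_def)
  have finA': "finite A'" using A'A fin(1) by (rule finite_subset)
  have finS: "finite S" using order.trans[OF SB' B'B] fin(2) by (rule finite_subset)
  have SR: "card S \<le> card R" by (rule column_rank_le_row_rank[OF R S fin])
  \<comment> \<open>\<open>Y0\<close> is moved into \<open>A'\<close> with all column parities kept.
    In the low-rank case the size of \<open>Y1\<close> counts; in the high-rank case only its
    parities do.\<close>
  obtain Y1 where Y1: "Y1 \<subseteq> A'" "card A' \<le> card Y1 + card R"
      "\<forall>b\<in>B. odd_in (\<lambda>a. E a b) Y1 \<longleftrightarrow> odd_in (\<lambda>a. E a b) Y0"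
    using information_set_large_solution[OF R fin(1) RA' A'A Y0] by blast
  show ?thesis
  \<comment> \<open>With n = |A| + |B|, the high-rank case yields at least 261n/1024 and the
    low-rank case at least 266n/1024; the target is 260n/1024.\<close>
  proof (cases "card A + card B \<le> 8 * card R")
    case True
    \<comment> \<open>The columns in \<open>S\<close> span the column space, so \<open>X0\<close>
      can be replaced by a subset of \<open>S\<close>, keeping the parity at every
      \<open>a\<close>.\<close>
    obtain X where X: "X \<subseteq> S" "\<forall>a\<in>A. odd_in (E a) X \<longleftrightarrow> odd_in (E a) X0"
      using information_set_sum_rows[OF S fin(2) X0] by blast
    have XB: "X \<subseteq> B" and finX: "finite X" using X SB' B'B finS by (auto simp: finite_subset)
    \<comment> \<open>Now only the columns in \<open>X\<close> impose conditions. The matrix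
      restricted to \<open>A'\<close> and \<open>X\<close> has rank at most \<open>card X\<close>,
      so the elements of \<open>A'\<close> lost in the repair are compensated by those of
      \<open>X\<close>.\<close>
    obtain Q q where Q: "Q \<subseteq> A'" "information_set E A' X Q q"
      by (rule information_set_exists[OF finA' finX order.refl])
    obtain Y where Y: "Y \<subseteq> A'" "card A' \<le> card Y + card Q"
        "\<forall>b\<in>X. odd_in (\<lambda>a. E a b) Y \<longleftrightarrow> odd_in (\<lambda>a. E a b) Y1"
      using information_set_large_solution[OF Q(2) finA' Q(1) order.refl Y1(1)] by blast
    have "card Q \<le> card X" by (rule information_set_card_le[OF Q(2) finA' finX])
    then have "card A' \<le> card Y + card X" using Y by linarith
    then have "65 * (card A + card B) \<le> 256 * (card Y + card X)"
      using True le wA[folded A'_def] by simp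
    moreover have "odd_in (E a) X" if "a \<in> Y" for a
      using subsetD[OF Y(1) that] X(2) by (simp add: A'_def)
    moreover have "odd_in (\<lambda>a. E a b) Y" if "b \<in> X" for b
      using subsetD[OF SB' subsetD[OF X(1) that]] Y(3) Y1(3) that by (simp add: B'_def)
    ultimately show ?thesis using order.trans[OF Y(1) A'A] XB by (intro exI conjI ballI)
  next
    case False
    obtain X where X: "X \<subseteq> B'" "card B' \<le> card X + card S"
        "\<forall>a\<in>A. odd_in (E a) X \<longleftrightarrow> odd_in (E a) X0"
      using information_set_large_solution[OF S fin(2) SB' B'B X0] by blast
    have "65 * (card A + card B) \<le> 256 * (card Y1 + card X)"
      using False SR wA[folded A'_def] wB[folded B'_def] X(2) Y1(2) by simp
    moreover have "odd_in (E a) X" if "a \<in> Y1" for a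
      using subsetD[OF Y1(1) that] X(3) by (simp add: A'_def)
    moreover have "odd_in (\<lambda>a. E a b) Y1" if "b \<in> X" for b
      using subsetD[OF X(1) that] Y1(3) by (simp add: B'_def)
    ultimately show ?thesis
      using order.trans[OF Y1(1) A'A] order.trans[OF X(1) B'B] by (intro exI conjI ballI)
  qed
qed

lemma bipartite_relation_odd_sets:
  assumes fin: "finite A" "finite B" and rows: "\<And>a. a \<in> A \<Longrightarrow> \<exists>b\<in>B. E a b"
    and cols: "\<And>b. b \<in> B \<Longrightarrow> \<exists>a\<in>A. E a b"
  shows "\<exists>Y\<subseteq>A. \<exists>X\<subseteq>B. (\<forall>a\<in>Y. odd_in (E a) X) \<and> (\<forall>b\<in>X. odd_in (\<lambda>a. E a b) Y)
           \<and> 65 * (card A + card B) \<le> 256 * (card Y + card X)"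
proof (cases "card B \<le> card A")
  case True
  then show ?thesis using bipartite_relation_odd_sets_le[OF fin rows cols] by blast
next
  case False
  then have "card A \<le> card B" by simp
  then obtain X Y where "X \<subseteq> B" "Y \<subseteq> A" "\<forall>b\<in>X. odd_in (\<lambda>a. E a b) Y"
      "\<forall>a\<in>Y. odd_in (E a) X" and large: "65 * (card B + card A) \<le> 256 * (card X + card Y)"
    using bipartite_relation_odd_sets_le[OF fin(2,1) cols rows] by blast
  moreover have "65 * (card A + card B) \<le> 256 * (card Y + card X)"
    using large by (simp only: add.commute)
  ultimately show ?thesis by blast
qed

section \<open>From the matrix back to the graph\<close>

lemma (in digraph) out_degree_induce_subgraph:
  assumes "S \<subseteq> verts G" "v \<in> S"
  shows "out_degree (G \<restriction> S) v = card {u \<in> S. (v, u) \<in> arcs_ends G}"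
proof -
  interpret H: digraph "G \<restriction> S"
    using assms(1) by (intro digraphI_induced induced_induce)
  have "{u. (v, u) \<in> arcs_ends (G \<restriction> S)} = {u \<in> S. (v, u) \<in> arcs_ends G}"
    using assms(2) by (auto simp: arcs_ends_conv)
  then show ?thesis by (simp add: H.out_degree_eq_card_neighbours)
qed

theorem theorem19:
  fixes G :: "('a, 'b) pre_digraph" and n :: nat
  assumes "Digraph.graph G"
    and "bipartite G"
    and "card (verts G) = n"
    and "min_degree G \<ge> 1"
  shows "real (f_o G) \<ge> (1 / 4 + 1 / 256) * real n
       \<and> (1 / 4 + 1 / 256) * real n = 65 * real n / 256"
proof -
  interpret graph G by fact
  obtain A B where AB: "A \<union> B = verts G" "A \<inter> B = {}"
    and sides: "\<forall>(u, v) \<in> arcs_ends G. (u \<in> A \<and> v \<in> B) \<or> (u \<in> B \<and> v \<in> A)"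
    using assms(2) unfolding bipartite_def by (elim exE conjE) (rule that)
  have arcs: "(u \<in> A \<and> v \<in> B) \<or> (u \<in> B \<and> v \<in> A)" if "(u, v) \<in> arcs_ends G" for u v
    using bspec[OF sides that] by simp
  have "finite (A \<union> B)" unfolding AB(1) by (rule finite_verts)
  then have fin: "finite A" "finite B" by simp_all
  have "sym (arcs_ends G)" using sym_arcs unfolding symmetric_def .
  then have sym: "(u, v) \<in> arcs_ends G \<longleftrightarrow> (v, u) \<in> arcs_ends G" for u v
    by (meson symD)
  \<comment> \<open>Minimum degree at least 1 means that the biadjacency matrix has no zero row and
    no zero column.\<close>
  have neighbour: "\<exists>u. (v, u) \<in> arcs_ends G" if v: "v \<in> verts G" for v
  proof -
    have "min_degree G \<le> out_degree G v"
      unfolding min_degree_def using v by (intro Min_le) auto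
    then have "card {u. (v, u) \<in> arcs_ends G} \<noteq> 0"
      using assms(4) by (simp add: out_degree_eq_card_neighbours)
    then have "{u. (v, u) \<in> arcs_ends G} \<noteq> {}" by (metis card.empty)
    then show ?thesis by blast
  qed
  let ?E = "\<lambda>u v. (u, v) \<in> arcs_ends G"
  have "\<exists>b\<in>B. ?E a b" if "a \<in> A" for a
    using neighbour[of a] arcs[of a] that AB by blast
  moreover have "\<exists>a\<in>A. ?E a b" if "b \<in> B" for b
    using neighbour[of b] arcs[of b] sym[of b] that AB by blast
  ultimately obtain Y X where Y: "Y \<subseteq> A" "\<forall>a\<in>Y. odd_in (?E a) X"
    and X: "X \<subseteq> B" "\<forall>b\<in>X. odd_in (\<lambda>a. ?E a b) Y"
    and large: "65 * (card A + card B) \<le> 256 * (card Y + card X)"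
    using bipartite_relation_odd_sets[OF fin, of ?E] by blast
  have S: "Y \<union> X \<subseteq> verts G" using X(1) Y(1) AB by auto
  have "odd (out_degree (G \<restriction> (Y \<union> X)) v)" if v: "v \<in> Y \<union> X" for v
  proof (cases "v \<in> Y")
    case True
    \<comment> \<open>No edge runs inside a side, so the induced degree counts only neighbours in
      the opposite set.\<close>
    then have "{u \<in> Y \<union> X. ?E v u} = {u \<in> X. ?E v u}"
      using arcs[of v] X(1) Y(1) AB(2) by blast
    then show ?thesis
      using True Y(2) out_degree_induce_subgraph[OF S v] by (simp add: odd_in_def)
  next
    case False
    then have "v \<in> X" using v by simp
    moreover from this have "{u \<in> Y \<union> X. ?E v u} = {u \<in> Y. ?E u v}"
      using arcs[of v] sym[of v] X(1) Y(1) AB(2) by blast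
    ultimately show ?thesis
      using X(2) out_degree_induce_subgraph[OF S v] by (simp add: odd_in_def)
  qed
  then have "odd_induced G (Y \<union> X)" using S by (simp add: odd_induced_def)
  then have "card (Y \<union> X) \<le> f_o G" by (rule f_o_attained(2))
  moreover have "card (Y \<union> X) = card Y + card X"
    using X(1) Y(1) AB(2) fin by (intro card_Un_disjoint) (auto intro: finite_subset)
  ultimately have "256 * (card Y + card X) \<le> 256 * f_o G" by simp
  moreover have "n = card A + card B"
    using card_Un_disjoint[OF fin AB(2)] assms(3) AB(1) by simp
  ultimately have "65 * n \<le> 256 * f_o G" using large by (simp only: order.trans)
  then have "real (65 * n) \<le> real (256 * f_o G)" by (simp only: of_nat_le_iff)
  then show ?thesis by (simp add: field_simps)
qed

end
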